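(* Let $l, u \in \mathbb{R}$ with $l < 0 < u$. Let $R \subseteq \mathbb{R}^2$ be the set of all pairs $(x, y)$ for which $l \le x \le u$ and there exists a real number $a$ with $0 \le a \le 1$ such that $$ y \le x - l(1-a), \qquad y \ge x, \qquad y \le u \cdot a, \qquad y \ge 0. $$ Then $R$ is equal to the convex hull of the graph $\{(x, \max(x, 0)) : l \le x \le u\}$.
   Context: The set $R$ is the projection to the $(x,y)$-plane of the relaxation obtained by replacing the integrality constraint $a \in \{0,1\}$ by $0 \le a \le 1$ in the mixed-integer formulation of the ReLU function $y = \max(x,0)$ for an input with bounds $l \le x \le u$. The property stated is what is meant by saying that the formulation is sharp. *)

theory Defs
  imports "HOL-Analysis.Analysis"
begin

definition relu_relaxation :: "real \<Rightarrow> real \<Rightarrow> (real \<times> real) set" where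
  "relu_relaxation l u =
     {(x, y). l \<le> x \<and> x \<le> u \<and>
        (\<exists>a::real. 0 \<le> a \<and> a \<le> 1 \<and>
           y \<le> x - l * (1 - a) \<and> y \<ge> x \<and> y \<le> u * a \<and> y \<ge> 0)}"

definition relu_graph :: "real \<Rightarrow> real \<Rightarrow> (real \<times> real) set" where
  "relu_graph l u = {(x, max x 0) | x. l \<le> x \<and> x \<le> u}"

end

(* R is convex, being a projection of a polyhedron, and contains the graph.  Conversely, R is
   contained in the triangle with vertices (l, 0), (0, 0), (u, u), which all lie on the graph. *)
theory Submission
  imports Defs
begin

text \<open>For the inclusion of R in the hull, eliminating \<open>a\<close> from the two upper
  bounds on \<open>y\<close> leaves \<open>(x - y) / l + y / u \<le> 1\<close>. Together with
  \<open>x \<le> y\<close> and \<open>0 \<le> y\<close> this says that the barycentric coordinates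
  of \<open>(x, y)\<close> in the triangle are nonnegative
  (\<open>relu_relaxation_subset_triangle\<close>). The other inclusion is minimality of the hull,
  by \<open>convex_relu_relaxation\<close> and \<open>relu_graph_subset_relaxation\<close>.\<close>

lemma convex_relu_relaxation: "convex (relu_relaxation l u)"
proof (rule convexI)
  fix p q :: "real \<times> real" and s t :: real
  assume p: "p \<in> relu_relaxation l u" and q: "q \<in> relu_relaxation l u"
    and s: "0 \<le> s" and t: "0 \<le> t" and st: "s + t = 1"
  obtain x y a where p_eq: "p = (x, y)"
    and p_le: "l \<le> x" "x \<le> u" "0 \<le> a" "a \<le> 1" "y \<le> x - l * (1 - a)" "x \<le> y" "y \<le> u * a" "0 \<le> y"
    using p by (auto simp: relu_relaxation_def)
  obtain x' y' a' where q_eq: "q = (x', y')"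
    and q_le: "l \<le> x'" "x' \<le> u" "0 \<le> a'" "a' \<le> 1" "y' \<le> x' - l * (1 - a')" "x' \<le> y'"
      "y' \<le> u * a'" "0 \<le> y'"
    using q by (auto simp: relu_relaxation_def)
  \<comment> \<open>Every constraint compares affine functions of \<open>(x, y, a)\<close>, so it
    survives weighted averaging; the same average of \<open>a\<close> and \<open>a'\<close> is the
    new witness.\<close>
  have combine: "s * b + t * b' \<le> s * c + t * c'" if "b \<le> c" "b' \<le> c'" for b b' c c'
    using that s t by (intro add_mono mult_left_mono)
  have const: "s * c + t * c = c" for c
    using st by (metis distrib_right mult_1)
  let ?x = "s * x + t * x'" and ?y = "s * y + t * y'" and ?a = "s * a + t * a'"
  have "l \<le> ?x" "?x \<le> u" "0 \<le> ?a" "?a \<le> 1" "?x \<le> ?y" "0 \<le> ?y"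
    using combine[OF p_le(1) q_le(1)] combine[OF p_le(2) q_le(2)] combine[OF p_le(3) q_le(3)]
      combine[OF p_le(4) q_le(4)] combine[OF p_le(6) q_le(6)] combine[OF p_le(8) q_le(8)]
    by (simp_all add: const st)
  moreover have "?y \<le> ?x - l * (1 - ?a)"
    using combine[OF p_le(5) q_le(5)] const[of l] by (simp add: algebra_simps)
  moreover have "?y \<le> u * ?a"
    using combine[OF p_le(7) q_le(7)] by (simp add: algebra_simps)
  ultimately show "s *\<^sub>R p + t *\<^sub>R q \<in> relu_relaxation l u"
    unfolding relu_relaxation_def p_eq q_eq by auto
qed

lemma relu_graph_subset_relaxation:
  assumes "l \<le> 0" and "0 \<le> u"
  shows "relu_graph l u \<subseteq> relu_relaxation l u"
proof
  fix p assume "p \<in> relu_graph l u"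
  then obtain x where p: "p = (x, max x 0)" and x: "l \<le> x" "x \<le> u"
    by (auto simp: relu_graph_def)
  have "\<exists>a. 0 \<le> a \<and> a \<le> 1 \<and> max x 0 \<le> x - l * (1 - a) \<and> max x 0 \<le> u * a"
    \<comment> \<open>\<open>a\<close> indicates the active branch: \<open>a = 1\<close> turns the
      upper bounds into \<open>y \<le> x\<close> and \<open>y \<le> u\<close>, \<open>a = 0\<close>
      into \<open>y \<le> x - l\<close> and \<open>y \<le> 0\<close>.\<close>
    using x assms by (intro exI[of _ "if 0 \<le> x then 1 else 0"]) auto
  then show "p \<in> relu_relaxation l u"
    using x by (auto simp: relu_relaxation_def p)
qed

lemma relu_relaxation_subset_triangle:
  assumes "l < 0" and "0 < u"
  shows "relu_relaxation l u \<subseteq> convex hull {(l, 0), (0, 0), (u, u)}"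
proof
  fix p assume "p \<in> relu_relaxation l u"
  then obtain x y a where p: "p = (x, y)"
    and le: "y \<le> x - l * (1 - a)" "x \<le> y" "y \<le> u * a" "0 \<le> y"
    by (auto simp: relu_relaxation_def)
  \<comment> \<open>The weights of \<open>(l, 0)\<close> and \<open>(u, u)\<close>: the second
    coordinate forces \<open>w * u = y\<close>, then the first forces \<open>v * l = x - y\<close>.
    Dividing by \<open>l < 0\<close> reverses inequalities.\<close>
  define v w where "v = (x - y) / l" and "w = y / u"
  have "v \<le> 1 - a"
    using le assms by (simp add: v_def neg_divide_le_eq mult.commute)
  moreover have "w \<le> a"
    using le assms by (simp add: w_def pos_divide_le_eq mult.commute)
  \<comment> \<open>Adding the two bounds cancels \<open>a\<close>; this is the weight of the
    origin.\<close>
  ultimately have "0 \<le> 1 - v - w"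
    by simp
  moreover have "0 \<le> v" "0 \<le> w"
    using le assms by (simp_all add: v_def w_def divide_nonpos_neg)
  moreover have "p = v *\<^sub>R (l, 0) + (1 - v - w) *\<^sub>R (0, 0) + w *\<^sub>R (u, u)"
    using assms by (simp add: p v_def w_def)
  moreover have "v + (1 - v - w) + w = 1"
    by simp
  ultimately show "p \<in> convex hull {(l, 0), (0, 0), (u, u)}"
    unfolding convex_hull_3 by blast
qed

theorem mainTheorem3:
  fixes l u :: real
  assumes "l < 0" and "0 < u"
  shows "relu_relaxation l u = convex hull (relu_graph l u)"
proof
  have "{(l, 0), (0, 0), (u, u)} \<subseteq> relu_graph l u"
    using assms by (auto simp: relu_graph_def)
  then show "relu_relaxation l u \<subseteq> convex hull (relu_graph l u)"
    using relu_relaxation_subset_triangle[OF assms] hull_mono by blast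
  show "convex hull (relu_graph l u) \<subseteq> relu_relaxation l u"
    using assms by (intro hull_minimal relu_graph_subset_relaxation convex_relu_relaxation) auto
qed

end
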